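(* Let $F\in\mathbb{N}\setminus\{0\}$ and $S\in\mathcal{A}(F)$. Then the set $A=\{x\in msg(S)\mid x\notin\Delta(\mathcal{A}(F))\}$ is the unique $\mathcal{A}(F)$-minimal system of generators of $S$.
   Context: Let $\mathbb{N}=\{0,1,2,\dots\}$. A numerical semigroup is a subset $S\subseteq\mathbb{N}$ that contains $0$, is closed under addition, and has finite complement $\mathbb{N}\setminus S$. Its Frobenius number is $F(S)=\max\{z\in\mathbb{Z}\mid z\notin S\}$. $msg(S)$ denotes the unique minimal system of generators of $S$ (the unique set generating $S$ as a submonoid of $(\mathbb{N},+)$ no proper subset of which generates $S$). For $F\in\mathbb{N}\setminus\{0\}$, $\mathcal{A}(F)$ is the set of all numerical semigroups with Frobenius number $F$; its minimum with respect to inclusion is $\Delta(\mathcal{A}(F))=\{0\}\cup\{z\in\mathbb{N}\mid z\ge F+1\}$. An $\mathcal{A}(F)$-set is a subset of $M\setminus\Delta(\mathcal{A}(F))$ for some maximal (with respect to inclusion) element $M$ of $\mathcal{A}(F)$. For an $\mathcal{A}(F)$-set $B$, $\mathcal{A}(F)(B)$ denotes the intersection of all elements of $\mathcal{A}(F)$ containing $B$ (it is the least element of $\mathcal{A}(F)$ containing $B$). An $\mathcal{A}(F)$-minimal system of generators of $S$ is an $\mathcal{A}(F)$-set $B$ such that $\mathcal{A}(F)(B)=S$ and $\mathcal{A}(F)(B')\neq S$ for every proper subset $B'\subsetneq B$. *)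

theory Defs
  imports Complex_Main
begin

definition submonoid_nat :: "nat set \<Rightarrow> bool" where
  "submonoid_nat S \<longleftrightarrow> 0 \<in> S \<and> (\<forall>x\<in>S. \<forall>y\<in>S. x + y \<in> S)"

definition numerical_semigroup :: "nat set \<Rightarrow> bool" where
  "numerical_semigroup S \<longleftrightarrow> submonoid_nat S \<and> finite (- S)"

text \<open>The maximum is taken over the integers, so that the numerical semigroup of all
  natural numbers has Frobenius number \<open>-1\<close>.\<close>

definition frobenius_number :: "nat set \<Rightarrow> int" where
  "frobenius_number S = (GREATEST z. z \<notin> int ` S)"

definition minimal_generating_set :: "nat set \<Rightarrow> nat set \<Rightarrow> bool" where
  "minimal_generating_set S A \<longleftrightarrow>
     submonoid_nat hull A = S \<and> (\<forall>A'. A' \<subset> A \<longrightarrow> submonoid_nat hull A' \<noteq> S)"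

text \<open>Well defined for every submonoid by \<open>ex1_minimal_generating_set\<close> below.\<close>

definition msg :: "nat set \<Rightarrow> nat set" where
  "msg S = (THE A. minimal_generating_set S A)"

definition semigroups_Frob :: "nat \<Rightarrow> nat set set" where
  "semigroups_Frob F = {S. numerical_semigroup S \<and> frobenius_number S = int F}"

text \<open>This is the least element of \<open>semigroups_Frob F\<close> for positive \<open>F\<close>; see
  \<open>Delta_Frob_mem\<close> and \<open>Delta_Frob_least\<close> below.\<close>

definition Delta_Frob :: "nat \<Rightarrow> nat set" where
  "Delta_Frob F = {0} \<union> {F + 1..}"

definition maximal_Frob :: "nat \<Rightarrow> nat set \<Rightarrow> bool" where
  "maximal_Frob F M \<longleftrightarrow>
     M \<in> semigroups_Frob F \<and> (\<forall>T\<in>semigroups_Frob F. M \<subseteq> T \<longrightarrow> T = M)"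

definition Frob_set :: "nat \<Rightarrow> nat set \<Rightarrow> bool" where
  "Frob_set F B \<longleftrightarrow> (\<exists>M. maximal_Frob F M \<and> B \<subseteq> M - Delta_Frob F)"

definition Frob_closure :: "nat \<Rightarrow> nat set \<Rightarrow> nat set" where
  "Frob_closure F B = \<Inter>{T \<in> semigroups_Frob F. B \<subseteq> T}"

definition Frob_minimal_generators :: "nat \<Rightarrow> nat set \<Rightarrow> nat set \<Rightarrow> bool" where
  "Frob_minimal_generators F S B \<longleftrightarrow>
     Frob_set F B \<and> Frob_closure F B = S \<and> (\<forall>B'. B' \<subset> B \<longrightarrow> Frob_closure F B' \<noteq> S)"

lemma ex1_minimal_generating_set:
  assumes S: "submonoid_nat S"
  shows "\<exists>!A. minimal_generating_set S A"
proof -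
  define M where "M = {x \<in> S. x \<noteq> 0 \<and> \<not> (\<exists>a\<in>S. \<exists>b\<in>S. a \<noteq> 0 \<and> b \<noteq> 0 \<and> x = a + b)}"
  have sub: "M \<subseteq> A" if A: "submonoid_nat hull A = S" for A
  proof
    fix x assume x: "x \<in> M"
    show "x \<in> A"
    proof (rule ccontr)
      assume "x \<notin> A"
      moreover have "A \<subseteq> S" using A hull_subset by metis
      ultimately have "A \<subseteq> S - {x}" by blast
      moreover have "submonoid_nat (S - {x})"
        unfolding submonoid_nat_def
      proof (intro conjI ballI)
        show "0 \<in> S - {x}" using S x by (auto simp: submonoid_nat_def M_def)
        fix a b assume ab: "a \<in> S - {x}" "b \<in> S - {x}"
        have "a + b \<noteq> x"
        proof
          assume "a + b = x"
          with ab have "a \<noteq> 0" "b \<noteq> 0" by auto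
          with ab x \<open>a + b = x\<close> show False unfolding M_def by blast
        qed
        thus "a + b \<in> S - {x}" using S ab by (auto simp: submonoid_nat_def)
      qed
      ultimately have "submonoid_nat hull A \<subseteq> S - {x}" by (rule hull_minimal)
      thus False using A x by (auto simp: M_def)
    qed
  qed
  have gen: "submonoid_nat hull M = S"
  proof
    show "submonoid_nat hull M \<subseteq> S" by (rule hull_minimal) (auto simp: M_def S)
    have "x \<in> T" if T: "submonoid_nat T" "M \<subseteq> T" and "x \<in> S" for x T
      using \<open>x \<in> S\<close>
    proof (induction x rule: less_induct)
      case (less x)
      show ?case
      proof (cases "x = 0 \<or> x \<in> M")
        case True
        thus ?thesis using T by (auto simp: submonoid_nat_def)
      next
        case False
        then obtain a b where ab: "a \<in> S" "b \<in> S" "a \<noteq> 0" "b \<noteq> 0" "x = a + b"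
          using less.prems unfolding M_def by blast
        hence "a \<in> T" "b \<in> T" using less.IH by auto
        thus ?thesis using T(1) ab(5) by (auto simp: submonoid_nat_def)
      qed
    qed
    thus "S \<subseteq> submonoid_nat hull M" unfolding hull_def by blast
  qed
  show ?thesis
  proof
    show "minimal_generating_set S M"
      unfolding minimal_generating_set_def using sub gen by blast
    show "A = M" if "minimal_generating_set S A" for A
      using that sub gen unfolding minimal_generating_set_def by blast
  qed
qed

lemma frobenius_number_eqI:
  assumes "z \<notin> int ` S" "\<And>w. w \<notin> int ` S \<Longrightarrow> w \<le> z"
  shows "frobenius_number S = z"
  unfolding frobenius_number_def by (rule Greatest_equality) (use assms in auto)

lemma Delta_Frob_mem:
  assumes "F \<noteq> 0"
  shows "Delta_Frob F \<in> semigroups_Frob F"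
proof -
  have "finite (- Delta_Frob F)"
    by (rule finite_subset[of _ "{..F}"]) (auto simp: Delta_Frob_def)
  moreover have "frobenius_number (Delta_Frob F) = int F"
  proof (rule frobenius_number_eqI)
    fix w assume w: "w \<notin> int ` Delta_Frob F"
    show "w \<le> int F"
    proof (rule ccontr)
      assume "\<not> w \<le> int F"
      hence "w = int (nat w)" "nat w \<in> Delta_Frob F" by (auto simp: Delta_Frob_def)
      thus False using w by blast
    qed
  qed (use assms in \<open>auto simp: Delta_Frob_def\<close>)
  ultimately show ?thesis
    by (auto simp: semigroups_Frob_def numerical_semigroup_def submonoid_nat_def Delta_Frob_def)
qed

lemma frobenius_number_ge:
  assumes "numerical_semigroup S" "w \<notin> int ` S"
  shows "w \<le> frobenius_number S"
proof -
  have fin: "finite (int ` (- S) \<union> {-1})"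
    using assms(1) by (auto simp: numerical_semigroup_def)
  let ?m = "Max (int ` (- S) \<union> {-1})"
  have le: "v \<le> ?m" if "v \<notin> int ` S" for v
  proof (cases "v < 0")
    case True
    moreover have "-1 \<le> ?m" using fin by (intro Max_ge) auto
    ultimately show ?thesis by linarith
  next
    case False
    hence "v \<in> int ` (- S)" using that by (auto intro!: image_eqI[of _ _ "nat v"])
    thus ?thesis using fin by (intro Max_ge) auto
  qed
  moreover have "?m \<in> int ` (- S) \<union> {-1}" by (rule Max_in[OF fin]) auto
  hence "?m \<notin> int ` S" by auto
  ultimately have "frobenius_number S = ?m" by (intro frobenius_number_eqI)
  thus ?thesis using le assms(2) by simp
qed

lemma Delta_Frob_least:
  assumes "T \<in> semigroups_Frob F"
  shows "Delta_Frob F \<subseteq> T"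
proof
  fix x assume x: "x \<in> Delta_Frob F"
  show "x \<in> T"
  proof (rule ccontr)
    assume "x \<notin> T"
    hence "int x \<notin> int ` T" by auto
    hence "int x \<le> int F"
      using frobenius_number_ge[of T "int x"] assms by (simp add: semigroups_Frob_def)
    with \<open>x \<notin> T\<close> show False
      using x assms
      by (auto simp: Delta_Frob_def semigroups_Frob_def numerical_semigroup_def submonoid_nat_def)
  qed
qed

end

theory Submission
  imports Defs
begin

text \<open>Removing a minimal generator \<open>x < F\<close> from \<open>S\<close> leaves a numerical semigroup with the
  same Frobenius number, so every \<open>B\<close> whose closure is \<open>S\<close> contains the set \<open>A\<close> of minimal
  generators below \<open>F\<close>. Conversely every semigroup with Frobenius number \<open>F\<close> contains \<open>{F + 1..}\<close>,
  so one that contains \<open>A\<close> contains all of \<open>msg S\<close> and hence \<open>S\<close>. Thus \<open>A\<close> is the least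
  set with closure \<open>S\<close>.\<close>

lemma submonoid_nat_hull: "submonoid_nat (submonoid_nat hull A)"
  unfolding hull_def submonoid_nat_def by blast

lemma minimal_generating_set_msg:
  "submonoid_nat S \<Longrightarrow> minimal_generating_set S (msg S)"
  unfolding msg_def by (rule theI') (rule ex1_minimal_generating_set)

lemma hull_msg: "submonoid_nat S \<Longrightarrow> submonoid_nat hull msg S = S"
  using minimal_generating_set_msg by (simp add: minimal_generating_set_def)

text \<open>By minimality \<open>x\<close> is not in the hull \<open>?H\<close> of the other
  generators, while every element of \<open>S\<close> below \<open>x\<close> is. A sum of two such
  elements therefore stays in \<open>?H\<close> and cannot equal \<open>x\<close>.\<close>

lemma submonoid_nat_remove_msg:
  assumes S: "submonoid_nat S" and x: "x \<in> msg S"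
  shows "submonoid_nat (S - {x})"
proof -
  let ?H = "submonoid_nat hull (msg S - {x})"
  have H: "0 \<in> ?H" "\<And>a b. a \<in> ?H \<Longrightarrow> b \<in> ?H \<Longrightarrow> a + b \<in> ?H"
    using submonoid_nat_hull[of "msg S - {x}"] by (auto simp: submonoid_nat_def)
  have sub: "msg S - {x} \<subseteq> ?H" by (rule hull_subset)
  have "x \<notin> ?H"
  proof
    assume "x \<in> ?H"
    with sub have "msg S \<subseteq> ?H" by blast
    then have "S \<subseteq> ?H"
      using hull_minimal[of "msg S" ?H submonoid_nat] submonoid_nat_hull hull_msg[OF S] by blast
    moreover have "?H \<subseteq> S"
      using hull_mono[of "msg S - {x}" "msg S" submonoid_nat] hull_msg[OF S] by blast
    ultimately have "?H = S" by blast
    moreover have "msg S - {x} \<subset> msg S" using x by blast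
    ultimately show False
      using minimal_generating_set_msg[OF S] unfolding minimal_generating_set_def by blast
  qed
  \<comment> \<open>Any sum with a summand at least \<open>x\<close> is again at least
    \<open>x\<close>. This submonoid contains all generators and agrees with \<open>?H\<close> below
    \<open>x\<close>.\<close>
  have "submonoid_nat (?H \<union> {x..})"
    using H by (auto simp: submonoid_nat_def)
  moreover have "msg S \<subseteq> ?H \<union> {x..}" using sub by auto
  ultimately have "S \<subseteq> ?H \<union> {x..}"
    using hull_minimal[of "msg S" "?H \<union> {x..}" submonoid_nat] hull_msg[OF S] by blast
  then have small: "a \<in> ?H" if "a \<in> S" "a < x" for a
    using that by auto
  have "a + b \<noteq> x" if ab: "a \<in> S - {x}" "b \<in> S - {x}" for a b
  proof
    assume "a + b = x"
    \<comment> \<open>Neither summand equals \<open>x\<close>, so neither is \<open>0\<close> and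
      both are smaller than \<open>x\<close>.\<close>
    moreover from this ab have "a < x" "b < x" by auto
    ultimately show False using small ab H(2) \<open>x \<notin> ?H\<close> by blast
  qed
  moreover have "x \<noteq> 0" using H(1) \<open>x \<notin> ?H\<close> by metis
  ultimately show ?thesis using S by (auto simp: submonoid_nat_def)
qed

lemma frobenius_number_notin:
  assumes "numerical_semigroup S"
  shows "frobenius_number S \<notin> int ` S"
proof -
  \<comment> \<open>The element \<open>-1\<close> bounds all negative integers and keeps the set
    nonempty when \<open>S\<close> has no gaps in the naturals.\<close>
  let ?G = "insert (-1) (int ` (- S))"
  have fin: "finite ?G" using assms by (simp add: numerical_semigroup_def)
  have "Max ?G \<in> ?G" by (rule Max_in[OF fin]) simp
  then have "Max ?G \<notin> int ` S" by auto
  moreover have "w \<le> Max ?G" if w: "w \<notin> int ` S" for w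
  proof (cases "w < 0")
    case True
    moreover have "-1 \<le> Max ?G" using fin by (intro Max_ge) auto
    ultimately show ?thesis by linarith
  next
    case False
    then have "w \<in> ?G" using w by (auto intro!: image_eqI[of _ _ "nat w"])
    then show ?thesis using fin by (rule Max_ge[rotated])
  qed
  ultimately show ?thesis by (simp add: frobenius_number_eqI)
qed

text \<open>The only new gap is \<open>x\<close>, and \<open>x\<close> is at most \<open>F\<close>
  because it lies outside \<open>Delta_Frob F\<close>; hence \<open>F\<close> remains the largest
  gap.\<close>

lemma semigroups_Frob_remove_msg:
  assumes S: "S \<in> semigroups_Frob F" and x: "x \<in> msg S" "x \<notin> Delta_Frob F"
  shows "S - {x} \<in> semigroups_Frob F"
proof -
  have num: "numerical_semigroup S" and frob: "frobenius_number S = int F"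
    using S by (auto simp: semigroups_Frob_def)
  have "frobenius_number (S - {x}) = int F"
  proof (rule frobenius_number_eqI)
    show "int F \<notin> int ` (S - {x})"
      using frobenius_number_notin[OF num] frob by auto
    fix w assume "w \<notin> int ` (S - {x})"
    then have "w \<notin> int ` S \<or> w = int x" by auto
    then show "w \<le> int F"
      using frobenius_number_ge[OF num] frob x(2) by (auto simp: Delta_Frob_def)
  qed
  moreover have "finite (- (S - {x}))"
    using num by (simp add: numerical_semigroup_def Compl_Diff_eq)
  ultimately show ?thesis
    using submonoid_nat_remove_msg[OF _ x(1)] num
    by (auto simp: semigroups_Frob_def numerical_semigroup_def)
qed

text \<open>All members contain \<open>{F + 1..}\<close>, so each is determined by its trace on
  \<open>{..F}\<close>. Finiteness supplies a maximal member above any given one.\<close>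

lemma finite_semigroups_Frob: "finite (semigroups_Frob F)"
proof (rule finite_subset)
  show "semigroups_Frob F \<subseteq> (\<lambda>X. X \<union> Delta_Frob F) ` Pow {..F}"
  proof
    fix T assume "T \<in> semigroups_Frob F"
    then have "Delta_Frob F \<subseteq> T" by (rule Delta_Frob_least)
    then have "T = (T \<inter> {..F}) \<union> Delta_Frob F" by (auto simp: Delta_Frob_def)
    then show "T \<in> (\<lambda>X. X \<union> Delta_Frob F) ` Pow {..F}" by blast
  qed
qed simp

lemma Frob_set_if_subset:
  assumes "S \<in> semigroups_Frob F" "B \<subseteq> S - Delta_Frob F"
  shows "Frob_set F B"
proof -
  obtain M where "M \<in> semigroups_Frob F" "S \<subseteq> M"
      "\<forall>T\<in>semigroups_Frob F. M \<subseteq> T \<longrightarrow> M = T"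
    using finite_has_maximal2[OF finite_semigroups_Frob assms(1)] by blast
  then show ?thesis
    using assms(2) unfolding Frob_set_def maximal_Frob_def by blast
qed

text \<open>If \<open>B\<close> missed such an \<open>x\<close>, then \<open>S - {x}\<close> would
  be a member of \<open>semigroups_Frob F\<close> containing \<open>B\<close>, so the closure would
  also miss \<open>x\<close>.\<close>

lemma subset_if_Frob_closure_eq:
  assumes S: "S \<in> semigroups_Frob F" and B: "Frob_closure F B = S"
  shows "{x \<in> msg S. x \<notin> Delta_Frob F} \<subseteq> B"
proof
  fix x assume x: "x \<in> {x \<in> msg S. x \<notin> Delta_Frob F}"
  show "x \<in> B"
  proof (rule ccontr)
    assume "x \<notin> B"
    moreover have "B \<subseteq> S" using B by (auto simp: Frob_closure_def)
    ultimately have "Frob_closure F B \<subseteq> S - {x}"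
      using semigroups_Frob_remove_msg[OF S] x unfolding Frob_closure_def by blast
    moreover have "x \<in> S"
      using x S hull_msg[of S] hull_subset[of "msg S" submonoid_nat]
      by (auto simp: semigroups_Frob_def numerical_semigroup_def)
    ultimately show False using B by blast
  qed
qed

lemma Frob_closure_msg:
  assumes S: "S \<in> semigroups_Frob F"
  shows "Frob_closure F {x \<in> msg S. x \<notin> Delta_Frob F} = S"
proof
  have hull: "submonoid_nat hull msg S = S"
    using S by (intro hull_msg) (simp add: semigroups_Frob_def numerical_semigroup_def)
  then have "msg S \<subseteq> S" using hull_subset by metis
  then show "Frob_closure F {x \<in> msg S. x \<notin> Delta_Frob F} \<subseteq> S"
    using S unfolding Frob_closure_def by blast
  have "S \<subseteq> T" if T: "T \<in> semigroups_Frob F" "{x \<in> msg S. x \<notin> Delta_Frob F} \<subseteq> T" for T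
  proof -
    \<comment> \<open>The generators not covered by the assumption on \<open>T\<close> lie in
      \<open>Delta_Frob F\<close>.\<close>
    have "msg S \<subseteq> T" using T(2) Delta_Frob_least[OF T(1)] by blast
    moreover have "submonoid_nat T"
      using T(1) by (simp add: semigroups_Frob_def numerical_semigroup_def)
    ultimately show ?thesis using hull_minimal hull by metis
  qed
  then show "S \<subseteq> Frob_closure F {x \<in> msg S. x \<notin> Delta_Frob F}"
    unfolding Frob_closure_def by blast
qed

theorem proposition4p5:
  fixes F :: nat and S :: "nat set"
  assumes "F \<noteq> 0" and "S \<in> semigroups_Frob F"
  shows "Frob_minimal_generators F S {x \<in> msg S. x \<notin> Delta_Frob F} \<and>
         (\<forall>B. Frob_minimal_generators F S B \<longrightarrow> B = {x \<in> msg S. x \<notin> Delta_Frob F})"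
proof -
  let ?A = "{x \<in> msg S. x \<notin> Delta_Frob F}"
  note closure = Frob_closure_msg[OF assms(2)]
  note least = subset_if_Frob_closure_eq[OF assms(2)]
  \<comment> \<open>As this closure is \<open>S\<close>, the inclusion places \<open>?A\<close>
    inside \<open>S\<close>.\<close>
  have "?A \<subseteq> Frob_closure F ?A" unfolding Frob_closure_def by blast
  then have "?A \<subseteq> S - Delta_Frob F" unfolding closure by blast
  then have "Frob_set F ?A" by (rule Frob_set_if_subset[OF assms(2)])
  moreover have "Frob_closure F B' \<noteq> S" if "B' \<subset> ?A" for B'
    using least[of B'] that by blast
  moreover have "B = ?A" if B: "Frob_minimal_generators F S B" for B
  proof (rule ccontr)
    assume "B \<noteq> ?A"
    moreover have "?A \<subseteq> B" using B least unfolding Frob_minimal_generators_def by blast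
    \<comment> \<open>A proper subset of \<open>B\<close> with closure \<open>S\<close> contradicts
      the minimality of \<open>B\<close>.\<close>
    ultimately have "?A \<subset> B" by blast
    then show False using B closure unfolding Frob_minimal_generators_def by blast
  qed
  ultimately show ?thesis using closure unfolding Frob_minimal_generators_def by blast
qed

end
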